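(* Let $\Bbbk$ be a field of characteristic different from $2$, let $\mathcal{J}$ be the super Jordan plane over $\Bbbk$, $s=xy+yx$, $\mathcal{J}_s$ the localization of $\mathcal{J}$ at the powers of $s$, and $y'=ys^{-1}\in\mathcal{J}_s$. Let $\mathcal{A}$ be the subalgebra of $\mathcal{J}_s$ generated by $y'^{\,2}$ and $s^{\pm1}$. Then $\mathcal{A}$ is a localization of the first Weyl algebra and $\mathcal{J}_s\cong M_2(\mathcal{A})$. More precisely, the map $\varphi:\mathcal{J}_s\to M_2(\mathcal{A})$ given by $$x\mapsto\begin{bmatrix} 0 & 0 \\ 1 & 0 \end{bmatrix},\qquad s^{\pm1}\mapsto\begin{bmatrix} s^{\pm1} & 0 \\ 0 & s^{\pm1} \end{bmatrix},\qquad y'\mapsto\begin{bmatrix} 0 & 1 \\ {y'}^{\,2} & 0 \end{bmatrix}$$ defines an algebra isomorphism.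
   Context: The super Jordan plane $\mathcal{J}$ over a field $\Bbbk$ is the unital associative $\Bbbk$-algebra generated by $x,y$ with defining relations $x^2=0$ and $y^2x-xy^2-xyx=0$. Put $s:=xy+yx$. The elements $x^is^jy^k$ ($i\in\{0,1\}$, $j,k\geq 0$) form a $\Bbbk$-basis of $\mathcal{J}$. The element $s$ is normal ($s\mathcal{J}=\mathcal{J}s$; indeed $sx=xs$, $sy=(y-x)s$) and regular, so the localization $\mathcal{J}_s$ at the powers of $s$ exists and contains $\mathcal{J}$. The first Weyl algebra $A_1$ is the $\Bbbk$-algebra generated by $\partial,t$ with the single relation $\partial t-t\partial=1$. *)

theory Defs
  imports
    "HOL-Analysis.Analysis"
    "HOL-Computational_Algebra.Polynomial"
    "HOL-Library.Poly_Mapping"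
begin

section \<open>Algebras over a field\<close>

locale assoc_algebra = vector_space scl
  for scl :: "'k::field \<Rightarrow> 'a::ring_1 \<Rightarrow> 'a" +
  assumes scale_mult_left: "scl c a * b = scl c (a * b)"
    and scale_mult_right: "a * scl c b = scl c (a * b)"

definition subalgebra :: "('k::field \<Rightarrow> 'a::ring_1 \<Rightarrow> 'a) \<Rightarrow> 'a set \<Rightarrow> bool" where
  "subalgebra scl B \<longleftrightarrow>
     module.subspace scl B \<and> 1 \<in> B \<and> (\<forall>a\<in>B. \<forall>b\<in>B. a * b \<in> B)"

definition algebra_hom ::
  "('k::field \<Rightarrow> 'a::ring_1 \<Rightarrow> 'a) \<Rightarrow> ('k \<Rightarrow> 'b::ring_1 \<Rightarrow> 'b) \<Rightarrow> ('a \<Rightarrow> 'b) \<Rightarrow> bool" where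
  "algebra_hom scl1 scl2 f \<longleftrightarrow>
     assoc_algebra scl1 \<and> assoc_algebra scl2 \<and> module_hom scl1 scl2 f \<and>
     f 1 = 1 \<and> (\<forall>a b. f (a * b) = f a * f b)"

text \<open>
  Localization of the algebra \<open>'r\<close> at a multiplicative set \<open>S\<close>, in the usual sense of
  noncommutative ring theory (right ring of fractions): elements of \<open>S\<close> become invertible,
  every element is a fraction \<open>\<iota> r (\<iota> s)\<inverse>\<close>, and the kernel of \<open>\<iota>\<close> is the \<open>S\<close>-torsion.
  These conditions determine the localization up to a unique isomorphism. The localized algebra is
  a subalgebra \<open>L\<close> of the type \<open>'l\<close>, possibly the whole type.
\<close>

definition is_localization ::
  "('k::field \<Rightarrow> 'r::ring_1 \<Rightarrow> 'r) \<Rightarrow> ('k \<Rightarrow> 'l::ring_1 \<Rightarrow> 'l) \<Rightarrow>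
   ('r \<Rightarrow> 'l) \<Rightarrow> 'r set \<Rightarrow> 'l set \<Rightarrow> bool" where
  "is_localization sclR sclL \<iota> S L \<longleftrightarrow>
     1 \<in> S \<and> (\<forall>s\<in>S. \<forall>t\<in>S. s * t \<in> S) \<and>
     subalgebra sclL L \<and> algebra_hom sclR sclL \<iota> \<and> (\<forall>r. \<iota> r \<in> L) \<and>
     (\<forall>s\<in>S. \<exists>u\<in>L. \<iota> s * u = 1 \<and> u * \<iota> s = 1) \<and>
     (\<forall>a\<in>L. \<exists>r. \<exists>s\<in>S. a * \<iota> s = \<iota> r) \<and>
     (\<forall>r. \<iota> r = 0 \<longleftrightarrow> (\<exists>s\<in>S. r * s = 0))"


section \<open>The matrix algebra\<close>

text \<open>
  The type \<open>'a^2^2\<close> carries the componentwise product as \<open>(*)\<close>; the matrix product is \<open>(**)\<close>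
  and the identity matrix is \<open>mat 1\<close>.
\<close>

definition mat2_over :: "'a set \<Rightarrow> ('a^2^2) set" where
  "mat2_over A = {M. \<forall>i j. M $ i $ j \<in> A}"

definition mat2_scale :: "('k \<Rightarrow> 'a \<Rightarrow> 'a) \<Rightarrow> 'k \<Rightarrow> 'a^2^2 \<Rightarrow> 'a^2^2" where
  "mat2_scale scl c M = (\<chi> i j. scl c (M $ i $ j))"

definition algebra_hom_mat2 ::
  "('k::field \<Rightarrow> 'a::ring_1 \<Rightarrow> 'a) \<Rightarrow> ('k \<Rightarrow> 'b::ring_1 \<Rightarrow> 'b) \<Rightarrow> 'b set \<Rightarrow>
   ('a \<Rightarrow> 'b^2^2) \<Rightarrow> bool" where
  "algebra_hom_mat2 scl1 scl2 B \<phi> \<longleftrightarrow>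
     assoc_algebra scl1 \<and> assoc_algebra scl2 \<and> subalgebra scl2 B \<and>
     (\<forall>a. \<phi> a \<in> mat2_over B) \<and>
     module_hom scl1 (mat2_scale scl2) \<phi> \<and>
     \<phi> 1 = mat 1 \<and> (\<forall>a b. \<phi> (a * b) = \<phi> a ** \<phi> b)"

definition mat2 :: "'a::zero \<Rightarrow> 'a \<Rightarrow> 'a \<Rightarrow> 'a \<Rightarrow> 'a^2^2" where
  "mat2 a b c d = vector [vector [a, b], vector [c, d]]"


section \<open>Free algebras and their quotients\<close>

text \<open>
  The free algebra on \<open>'g\<close> is the monoid algebra of the free monoid on \<open>'g\<close>; the latter is written
  additively because the convolution product on \<open>_ \<Rightarrow>\<^sub>0 _\<close> is based on \<open>monoid_add\<close>.
\<close>

datatype 'g free_monoid = Word (letters: "'g list")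

instantiation free_monoid :: (type) monoid_add
begin

definition zero_free_monoid :: "'a free_monoid" where
  "0 = Word []"

definition plus_free_monoid :: "'a free_monoid \<Rightarrow> 'a free_monoid \<Rightarrow> 'a free_monoid" where
  "u + v = Word (letters u @ letters v)"

instance
  by standard (simp_all add: zero_free_monoid_def plus_free_monoid_def)

end

type_synonym ('g, 'k) free_algebra = "'g free_monoid \<Rightarrow>\<^sub>0 'k"

definition free_gen :: "'g \<Rightarrow> ('g, 'k::field) free_algebra" where
  "free_gen g = Poly_Mapping.single (Word [g]) 1"

definition free_scalar :: "'k::field \<Rightarrow> ('g, 'k) free_algebra" where
  "free_scalar c = Poly_Mapping.single 0 c"

definition two_sided_ideal :: "'a::ring_1 set \<Rightarrow> bool" where
  "two_sided_ideal I \<longleftrightarrow>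
     0 \<in> I \<and> (\<forall>a\<in>I. \<forall>b\<in>I. a + b \<in> I) \<and> (\<forall>r. \<forall>a\<in>I. r * a \<in> I \<and> a * r \<in> I)"

definition ideal_cong :: "'a::ring_1 set \<Rightarrow> 'a \<Rightarrow> 'a \<Rightarrow> bool" where
  "ideal_cong R a b \<longleftrightarrow> a - b \<in> two_sided_ideal hull R"

lemma two_sided_ideal_hull: "two_sided_ideal (two_sided_ideal hull R)"
  by (rule hull_in) (auto simp: two_sided_ideal_def)

lemma ideal_hull_0: "0 \<in> two_sided_ideal hull R"
  and ideal_hull_add:
    "a \<in> two_sided_ideal hull R \<Longrightarrow> b \<in> two_sided_ideal hull R \<Longrightarrow> a + b \<in> two_sided_ideal hull R"
  and ideal_hull_mult_left: "a \<in> two_sided_ideal hull R \<Longrightarrow> r * a \<in> two_sided_ideal hull R"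
  and ideal_hull_mult_right: "a \<in> two_sided_ideal hull R \<Longrightarrow> a * r \<in> two_sided_ideal hull R"
  using two_sided_ideal_hull[of R] unfolding two_sided_ideal_def by blast+

lemma ideal_hull_uminus: "a \<in> two_sided_ideal hull R \<Longrightarrow> - a \<in> two_sided_ideal hull R"
  using ideal_hull_mult_left[of a R "-1"] by simp

lemma ideal_cong_equivp: "equivp (ideal_cong R)"
proof (rule equivpI)
  show "reflp (ideal_cong R)"
    by (simp add: reflp_def ideal_cong_def ideal_hull_0)
  show "symp (ideal_cong R)"
    unfolding symp_def ideal_cong_def by (metis ideal_hull_uminus minus_diff_eq)
  show "transp (ideal_cong R)"
    unfolding transp_def ideal_cong_def
    by (metis ideal_hull_add add_diff_eq diff_add_cancel)
qed

lemma ideal_cong_add: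
  assumes "ideal_cong R a b" "ideal_cong R c d"
  shows "ideal_cong R (a + c) (b + d)"
  using ideal_hull_add[OF assms[unfolded ideal_cong_def]]
  by (simp add: ideal_cong_def add_diff_add)

lemma ideal_cong_uminus:
  assumes "ideal_cong R a b"
  shows "ideal_cong R (- a) (- b)"
  using ideal_hull_uminus[OF assms[unfolded ideal_cong_def]]
  by (simp add: ideal_cong_def)

lemma ideal_cong_diff:
  assumes "ideal_cong R a b" "ideal_cong R c d"
  shows "ideal_cong R (a - c) (b - d)"
  using ideal_cong_add[OF assms(1) ideal_cong_uminus[OF assms(2)]] by simp

lemma ideal_cong_mult:
  assumes "ideal_cong R a b" "ideal_cong R c d"
  shows "ideal_cong R (a * c) (b * d)"
proof -
  have "a * c - b * d = (a - b) * c + b * (c - d)"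
    by (simp add: algebra_simps)
  then show ?thesis
    using assms unfolding ideal_cong_def
    by (metis ideal_hull_add ideal_hull_mult_left ideal_hull_mult_right)
qed

text \<open>
  Modules over a free algebra, realised on the vector space of polynomials. They only serve to show
  that the quotients below are nontrivial, as \<open>ring_1\<close> requires.
\<close>

definition free_act :: "('g \<Rightarrow> 'k poly \<Rightarrow> 'k poly) \<Rightarrow> ('g, 'k::field) free_algebra \<Rightarrow> 'k poly \<Rightarrow> 'k poly"
  where "free_act \<alpha> p f = (\<Sum>w\<in>Poly_Mapping.keys p. smult (Poly_Mapping.lookup p w) (foldr \<alpha> (letters w) f))"

lemma free_act_superset:
  assumes "finite K" "Poly_Mapping.keys p \<subseteq> K"
  shows "free_act \<alpha> p f = (\<Sum>w\<in>K. smult (Poly_Mapping.lookup p w) (foldr \<alpha> (letters w) f))"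
  unfolding free_act_def
  by (rule sum.mono_neutral_left) (use assms in \<open>auto simp: in_keys_iff\<close>)

lemma free_act_add: "free_act \<alpha> (p + q) f = free_act \<alpha> p f + free_act \<alpha> q f"
proof -
  let ?K = "Poly_Mapping.keys p \<union> Poly_Mapping.keys q"
  have "Poly_Mapping.keys (p + q) \<subseteq> ?K"
    by (rule Poly_Mapping.keys_add)
  then show ?thesis
    by (simp add: free_act_superset[of ?K] lookup_add smult_add_left sum.distrib)
qed

lemma free_act_single:
  "free_act \<alpha> (Poly_Mapping.single w c) f = smult c (foldr \<alpha> (letters w) f)"
  by (subst free_act_superset[of "{w}"]) auto

lemma free_act_0: "free_act \<alpha> 0 f = 0"
  by (simp add: free_act_def)

lemma free_algebra_induct:
  fixes p :: "('g, 'k::field) free_algebra"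
  assumes "P 0" "\<And>p w c. P p \<Longrightarrow> P (p + Poly_Mapping.single w c)"
  shows "P p"
proof (induction p rule: update_induct)
  case const
  then show ?case
    by (fact assms(1))
next
  case (update p w c)
  have "Poly_Mapping.update w c p = p + Poly_Mapping.single w c"
    using update(1)
    by (intro poly_mapping_eqI) (auto simp: lookup_update lookup_add lookup_single in_keys_iff)
  then show ?case
    using assms(2)[OF update.IH] by simp
qed

lemma free_act_uminus: "free_act \<alpha> (- p) f = - free_act \<alpha> p f"
  by (metis add_eq_0_iff ab_left_minus free_act_0 free_act_add)

lemma free_act_diff: "free_act \<alpha> (p - q) f = free_act \<alpha> p f - free_act \<alpha> q f"
  using free_act_add[of \<alpha> p "- q" f] by (simp add: free_act_uminus)

lemma free_act_mult:
  assumes add: "\<And>g f h. \<alpha> g (f + h) = \<alpha> g f + \<alpha> g h"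
    and smult: "\<And>g c f. \<alpha> g (smult c f) = smult c (\<alpha> g f)"
  shows "free_act \<alpha> (p * q) f = free_act \<alpha> p (free_act \<alpha> q f)"
proof -
  have fold_add: "foldr \<alpha> ws (f + h) = foldr \<alpha> ws f + foldr \<alpha> ws h" for ws f h
    by (induction ws) (simp_all add: add)
  have fold_smult: "foldr \<alpha> ws (smult c f) = smult c (foldr \<alpha> ws f)" for ws c f
    by (induction ws) (simp_all add: smult)
  have act_add: "free_act \<alpha> p (f + h) = free_act \<alpha> p f + free_act \<alpha> p h" for p f h
    by (simp add: free_act_def fold_add smult_add_right sum.distrib)
  have fold_0: "foldr \<alpha> ws 0 = 0" for ws
    using fold_smult[of ws 0 0] by simp
  have act_0: "free_act \<alpha> p 0 = 0" for p
    by (simp add: free_act_def fold_0)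
  have single: "free_act \<alpha> (Poly_Mapping.single v c * q) f = free_act \<alpha> (Poly_Mapping.single v c) (free_act \<alpha> q f)" for v c
    by (induction q rule: free_algebra_induct)
      (simp_all add: free_act_0 act_0 distrib_left free_act_add act_add mult_single
         free_act_single fold_0 fold_add fold_smult smult_add_right plus_free_monoid_def)
  show ?thesis
    by (induction p rule: free_algebra_induct)
      (simp_all add: free_act_0 distrib_right free_act_add single)
qed

lemma one_notin_ideal_hull:
  fixes R :: "('g, 'k::field) free_algebra set"
  assumes add: "\<And>g f h. \<alpha> g (f + h) = \<alpha> g f + \<alpha> g h"
    and smult: "\<And>g c f. \<alpha> g (smult c f) = smult c (\<alpha> g f)"
    and rels: "\<And>p f. p \<in> R \<Longrightarrow> free_act \<alpha> p f = 0"
  shows "1 \<notin> two_sided_ideal hull R"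
proof
  let ?I = "{p. \<forall>f. free_act \<alpha> p f = 0}"
  note mult = free_act_mult[of \<alpha>, OF add smult]
  have "free_act \<alpha> p 0 = 0" for p
    using mult[of p 0 0] by (simp add: free_act_0)
  then have "two_sided_ideal ?I"
    by (auto simp: two_sided_ideal_def free_act_0 free_act_add mult)
  then have "two_sided_ideal hull R \<subseteq> ?I"
    by (intro hull_minimal) (auto simp: rels)
  moreover assume "1 \<in> two_sided_ideal hull R"
  ultimately have "free_act \<alpha> 1 1 = 0"
    by blast
  then show False
    by (simp add: free_act_single zero_free_monoid_def flip: single_one)
qed


section \<open>The super Jordan plane\<close>

datatype sj_gen = SJ_x | SJ_y

definition sj_rels :: "(sj_gen, 'k::field) free_algebra set" where
  "sj_rels =
     (let x = free_gen SJ_x; y = free_gen SJ_y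
      in {x^2, y^2 * x - x * y^2 - x * y * x})"

quotient_type (overloaded) 'k super_jordan =
  "(sj_gen, 'k::field) free_algebra" / "ideal_cong sj_rels"
  by (rule ideal_cong_equivp)

lemma sj_nontrivial: "\<not> ideal_cong sj_rels 0 (1 :: (sj_gen, 'k::field) free_algebra)"
proof
  assume "ideal_cong sj_rels 0 (1 :: (sj_gen, 'k) free_algebra)"
  then have "1 \<in> two_sided_ideal hull (sj_rels :: (sj_gen, 'k) free_algebra set)"
    unfolding ideal_cong_def using ideal_hull_uminus by fastforce
  moreover have "1 \<notin> two_sided_ideal hull (sj_rels :: (sj_gen, 'k) free_algebra set)"
    by (rule one_notin_ideal_hull[of "\<lambda>_ _. 0"])
      (auto simp: sj_rels_def Let_def free_gen_def mult_single power2_eq_square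
         free_act_diff free_act_single plus_free_monoid_def)
  ultimately show False
    by blast
qed

instantiation super_jordan :: (field) ring_1
begin

lift_definition zero_super_jordan :: "'a super_jordan" is 0 .
lift_definition one_super_jordan :: "'a super_jordan" is 1 .
lift_definition plus_super_jordan :: "'a super_jordan \<Rightarrow> 'a super_jordan \<Rightarrow> 'a super_jordan"
  is "(+)" by (rule ideal_cong_add)
lift_definition minus_super_jordan :: "'a super_jordan \<Rightarrow> 'a super_jordan \<Rightarrow> 'a super_jordan"
  is "(-)" by (rule ideal_cong_diff)
lift_definition uminus_super_jordan :: "'a super_jordan \<Rightarrow> 'a super_jordan"
  is uminus by (rule ideal_cong_uminus)
lift_definition times_super_jordan :: "'a super_jordan \<Rightarrow> 'a super_jordan \<Rightarrow> 'a super_jordan"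
  is "(*)" by (rule ideal_cong_mult)

instance
  by standard
    (transfer; simp add: algebra_simps sj_nontrivial equivp_reflp[OF ideal_cong_equivp])+

end

lift_definition sj_x :: "'k::field super_jordan" is "free_gen SJ_x" .
lift_definition sj_y :: "'k::field super_jordan" is "free_gen SJ_y" .

lift_definition sj_scale :: "'k::field \<Rightarrow> 'k super_jordan \<Rightarrow> 'k super_jordan"
  is "\<lambda>c p. free_scalar c * p"
  by (intro ideal_cong_mult equivp_reflp[OF ideal_cong_equivp])

definition sj_s :: "'k::field super_jordan" where
  "sj_s = sj_x * sj_y + sj_y * sj_x"


section \<open>The first Weyl algebra\<close>

datatype weyl_gen = Weyl_d | Weyl_t

definition weyl_rels :: "(weyl_gen, 'k::field) free_algebra set" where
  "weyl_rels =
     (let d = free_gen Weyl_d; t = free_gen Weyl_t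
      in {d * t - t * d - 1})"

quotient_type (overloaded) 'k weyl =
  "(weyl_gen, 'k::field) free_algebra" / "ideal_cong weyl_rels"
  by (rule ideal_cong_equivp)

lemma weyl_nontrivial: "\<not> ideal_cong weyl_rels 0 (1 :: (weyl_gen, 'k::field) free_algebra)"
proof
  define \<alpha> :: "weyl_gen \<Rightarrow> 'k poly \<Rightarrow> 'k poly"
    where "\<alpha> g = (case g of Weyl_d \<Rightarrow> pderiv | Weyl_t \<Rightarrow> (*) [:0, 1:])" for g
  assume "ideal_cong weyl_rels 0 (1 :: (weyl_gen, 'k) free_algebra)"
  then have "1 \<in> two_sided_ideal hull (weyl_rels :: (weyl_gen, 'k) free_algebra set)"
    unfolding ideal_cong_def using ideal_hull_uminus by fastforce
  moreover have "1 \<notin> two_sided_ideal hull (weyl_rels :: (weyl_gen, 'k) free_algebra set)"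
  proof (rule one_notin_ideal_hull[of \<alpha>])
    show "\<alpha> g (f + h) = \<alpha> g f + \<alpha> g h" for g f h
      by (cases g) (simp_all add: \<alpha>_def pderiv_add distrib_left)
    show "\<alpha> g (smult c f) = smult c (\<alpha> g f)" for g c f
      by (cases g) (simp_all add: \<alpha>_def pderiv_smult)
    show "free_act \<alpha> p f = 0" if "p \<in> weyl_rels" for p f
      using that
      by (auto simp: weyl_rels_def Let_def free_gen_def mult_single free_act_diff
          free_act_single plus_free_monoid_def zero_free_monoid_def \<alpha>_def pderiv_mult pderiv_pCons
          simp flip: single_one)
  qed
  ultimately show False
    by blast
qed

instantiation weyl :: (field) ring_1
begin

lift_definition zero_weyl :: "'a weyl" is 0 .
lift_definition one_weyl :: "'a weyl" is 1 .
lift_definition plus_weyl :: "'a weyl \<Rightarrow> 'a weyl \<Rightarrow> 'a weyl" is "(+)" by (rule ideal_cong_add)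
lift_definition minus_weyl :: "'a weyl \<Rightarrow> 'a weyl \<Rightarrow> 'a weyl" is "(-)" by (rule ideal_cong_diff)
lift_definition uminus_weyl :: "'a weyl \<Rightarrow> 'a weyl" is uminus by (rule ideal_cong_uminus)
lift_definition times_weyl :: "'a weyl \<Rightarrow> 'a weyl \<Rightarrow> 'a weyl" is "(*)" by (rule ideal_cong_mult)

instance
  by standard
    (transfer; simp add: algebra_simps weyl_nontrivial equivp_reflp[OF ideal_cong_equivp])+

end

lift_definition weyl_scale :: "'k::field \<Rightarrow> 'k weyl \<Rightarrow> 'k weyl"
  is "\<lambda>c p. free_scalar c * p"
  by (intro ideal_cong_mult equivp_reflp[OF ideal_cong_equivp])

end

theory Submission
  imports Defs
begin

text \<open>
  In the localization, \<open>s y' = y' s - x\<close> gives \<open>x y' + y' x = 1\<close> and \<open>y'^2 s - s y'^2 = 1\<close>. Together with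
  \<open>x^2 = 0\<close>, the first of these makes \<open>y' x\<close>, \<open>y' x y'\<close>, \<open>x\<close>, \<open>x y'\<close> a system of \<open>2 \<times> 2\<close> matrix units,
  which commute with \<open>y'^2\<close> and \<open>s\<close>. The entries of \<open>a\<close> with respect to them are
  \<open>\<Sum>\<^sub>k e\<^sub>k\<^sub>i a e\<^sub>j\<^sub>k\<close>; they lie in \<open>A\<close> because those of the generators do.

  The second identity gives the homomorphism from the Weyl algebra to \<open>A\<close>. No basis is needed for
  its kernel: the super Jordan plane acts on pairs of elements of the Weyl algebra such that \<open>s\<close> acts as
  left multiplication by \<open>t\<close>, and for each \<open>r\<close> in the Weyl algebra some \<open>f(r) s^N\<close> lifts to an element
  acting as left multiplication by \<open>r t^N\<close>. If \<open>f(r) = 0\<close>, this lift is killed by a power of \<open>s\<close>, so \<open>r\<close>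
  is killed by a power of \<open>t\<close>.
\<close>

section \<open>Free algebras\<close>

lemma free_scalar_commute: "free_scalar c * p = p * (free_scalar c :: ('g, 'k::field) free_algebra)"
  by (induction p rule: free_algebra_induct)
    (simp_all add: free_scalar_def algebra_simps mult_single)

lemma assoc_algebra_free: "assoc_algebra (\<lambda>c p. free_scalar c * p :: ('g, 'k::field) free_algebra)"
proof
  fix c d :: 'k and p q :: "('g, 'k) free_algebra"
  show "free_scalar c * (p + q) = free_scalar c * p + free_scalar c * q"
    by (simp add: distrib_left)
  show "free_scalar (c + d) * p = free_scalar c * p + free_scalar d * p"
    by (simp add: free_scalar_def single_add distrib_right)
  show "free_scalar c * (free_scalar d * p) = free_scalar (c * d) * p"
    by (simp add: free_scalar_def mult_single flip: mult.assoc)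
  show "free_scalar 1 * p = p"
    by (simp add: free_scalar_def)
  show "free_scalar c * p * q = free_scalar c * (p * q)"
    by (simp add: mult.assoc)
  show "p * (free_scalar c * q) = free_scalar c * (p * q)"
    by (metis free_scalar_commute mult.assoc)
qed

text \<open>Words grow by letters on the left, so left multiplication by generators is the only
  product step. The zero element is \<open>0\<close> times \<open>1\<close>.\<close>

lemma free_algebra_word_induct:
  fixes p :: "('g, 'k::field) free_algebra"
  assumes "P 1"
    and "\<And>a b. P a \<Longrightarrow> P b \<Longrightarrow> P (a + b)"
    and "\<And>c a. P a \<Longrightarrow> P (free_scalar c * a)"
    and "\<And>g a. P a \<Longrightarrow> P (free_gen g * a)"
  shows "P p"
proof (induction p rule: free_algebra_induct)
  case 1
  then show ?case
    using assms(3)[OF assms(1), of 0] by (simp add: free_scalar_def)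
next
  case (2 p w c)
  have "P (Poly_Mapping.single (Word gs) 1)" for gs
  proof (induction gs)
    case Nil
    then show ?case
      using assms(1) by (simp add: zero_free_monoid_def flip: single_one)
  next
    case (Cons g gs)
    from assms(4)[OF this, of g] show ?case
      by (simp add: free_gen_def mult_single plus_free_monoid_def)
  qed
  from assms(3)[OF this[of "letters w"], of c] have "P (Poly_Mapping.single w c)"
    by (simp add: free_scalar_def mult_single)
  with 2 show ?case
    by (rule assms(2))
qed

text \<open>Generalises \<open>free_act\<close> from polynomials to any vector space. It is used for
  an algebra acting on itself by left multiplication and for an action of the super Jordan
  plane.\<close>

locale free_algebra_action = vector_space scl
  for scl :: "'k::field \<Rightarrow> 'v::ab_group_add \<Rightarrow> 'v" +
  fixes \<alpha> :: "'g \<Rightarrow> 'v \<Rightarrow> 'v"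
  assumes linear: "module_hom scl scl (\<alpha> g)"
begin

definition act :: "('g, 'k) free_algebra \<Rightarrow> 'v \<Rightarrow> 'v" where
  "act p v = (\<Sum>w\<in>Poly_Mapping.keys p. scl (Poly_Mapping.lookup p w) (foldr \<alpha> (letters w) v))"

lemma act_superset:
  assumes "finite K" "Poly_Mapping.keys p \<subseteq> K"
  shows "act p v = (\<Sum>w\<in>K. scl (Poly_Mapping.lookup p w) (foldr \<alpha> (letters w) v))"
  unfolding act_def
  by (rule sum.mono_neutral_left) (use assms in \<open>auto simp: in_keys_iff\<close>)

lemma act_add: "act (p + q) v = act p v + act q v"
proof -
  let ?K = "Poly_Mapping.keys p \<union> Poly_Mapping.keys q"
  have "Poly_Mapping.keys (p + q) \<subseteq> ?K"
    by (rule Poly_Mapping.keys_add)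
  then show ?thesis
    by (simp add: act_superset[of ?K] lookup_add scale_left_distrib sum.distrib)
qed

lemma act_single: "act (Poly_Mapping.single w c) v = scl c (foldr \<alpha> (letters w) v)"
  by (subst act_superset[of "{w}"]) auto

lemma act_0: "act 0 v = 0"
  by (simp add: act_def)

lemma act_1: "act 1 v = v"
  by (simp add: act_single zero_free_monoid_def flip: single_one)

lemma act_gen: "act (free_gen g) v = \<alpha> g v"
  by (simp add: free_gen_def act_single)

lemma act_diff: "act (p - q) v = act p v - act q v"
  using act_add[of "p - q" q v] by (simp add: algebra_simps)

lemma foldr_linear: "module_hom scl scl (foldr \<alpha> ws)"
proof (induction ws)
  case Nil
  then show ?case
    by (simp add: module_hom_ident flip: id_def) (unfold_locales; simp add: scale_right_distrib scale_left_distrib)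
next
  case (Cons g ws)
  then show ?case
    using module_hom_compose[OF Cons linear[of g]] by (simp add: comp_def)
qed

lemmas foldr_simps =
  module_hom.add[OF foldr_linear] module_hom.scale[OF foldr_linear] module_hom.zero[OF foldr_linear]

lemma act_add_right: "act p (v + w) = act p v + act p w"
  by (simp add: act_def foldr_simps scale_right_distrib sum.distrib)

lemma act_0_right: "act p 0 = 0"
  by (simp add: act_def foldr_simps)

lemma act_mult: "act (p * q) v = act p (act q v)"
proof -
  have single: "act (Poly_Mapping.single w c * q) v = act (Poly_Mapping.single w c) (act q v)" for w c
    by (induction q rule: free_algebra_induct)
      (simp_all add: act_0 act_0_right distrib_left act_add act_add_right mult_single
         act_single foldr_simps plus_free_monoid_def)
  show ?thesis
    by (induction p rule: free_algebra_induct)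
      (simp_all add: act_0 distrib_right act_add single)
qed

lemma act_scalar: "act (free_scalar c) v = scl c v"
  by (simp add: free_scalar_def act_single zero_free_monoid_def)

text \<open>The annihilator of a module is a two-sided ideal, so it contains the ideal generated by
  \<open>R\<close> once it contains \<open>R\<close>. Hence the action descends to the
  quotient.\<close>

lemma act_ideal_cong:
  assumes "\<And>r v. r \<in> R \<Longrightarrow> act r v = 0" and "ideal_cong R p q"
  shows "act p v = act q v"
proof -
  let ?I = "{p. \<forall>v. act p v = 0}"
  have "two_sided_ideal ?I"
    by (auto simp: two_sided_ideal_def act_0 act_add act_mult act_0_right)
  then have "two_sided_ideal hull R \<subseteq> ?I"
    by (intro hull_minimal) (auto simp: assms(1))
  then have "act (p - q) v = 0"
    using assms(2) unfolding ideal_cong_def by blast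
  then show ?thesis
    by (simp add: act_diff)
qed

end


section \<open>Presentations by generators and relations\<close>

lift_definition weyl_d :: "'k::field weyl" is "free_gen Weyl_d" .
lift_definition weyl_t :: "'k::field weyl" is "free_gen Weyl_t" .

lemma weyl_commutator: "weyl_d * weyl_t = weyl_t * weyl_d + (1 :: 'k::field weyl)"
proof transfer
  show "ideal_cong weyl_rels (free_gen Weyl_d * free_gen Weyl_t)
      (free_gen Weyl_t * free_gen Weyl_d + (1 :: (weyl_gen, 'k) free_algebra))"
    unfolding ideal_cong_def
    by (rule hull_inc) (simp add: weyl_rels_def Let_def algebra_simps)
qed

lemma weyl_commutator_assoc: "weyl_d * (weyl_t * a) = weyl_t * (weyl_d * a) + (a :: 'k::field weyl)"
  by (simp add: weyl_commutator distrib_right flip: mult.assoc)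

lemma sj_x_square: "sj_x * sj_x = (0 :: 'k::field super_jordan)"
proof transfer
  show "ideal_cong sj_rels (free_gen SJ_x * free_gen SJ_x) (0 :: (sj_gen, 'k) free_algebra)"
    unfolding ideal_cong_def
    by (rule hull_inc) (simp add: sj_rels_def Let_def power2_eq_square)
qed

lemma sj_relation:
  "sj_y * (sj_y * sj_x) = sj_x * (sj_y * sj_y) + sj_x * (sj_y * (sj_x :: 'k::field super_jordan))"
proof transfer
  show "ideal_cong sj_rels (free_gen SJ_y * (free_gen SJ_y * free_gen SJ_x))
      (free_gen SJ_x * (free_gen SJ_y * free_gen SJ_y) +
       free_gen SJ_x * (free_gen SJ_y * (free_gen SJ_x :: (sj_gen, 'k) free_algebra)))"
    unfolding ideal_cong_def
    by (rule hull_inc) (simp add: sj_rels_def Let_def power2_eq_square algebra_simps)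
qed

lemma assoc_algebra_weyl: "assoc_algebra (weyl_scale :: 'k::field \<Rightarrow> _)"
proof -
  interpret F: assoc_algebra "\<lambda>c p. free_scalar c * p :: (weyl_gen, 'k) free_algebra"
    by (rule assoc_algebra_free)
  note [simp] = equivp_reflp[OF ideal_cong_equivp]
  show ?thesis
  proof
    fix c d :: 'k and p q :: "'k weyl"
    show "weyl_scale c (p + q) = weyl_scale c p + weyl_scale c q"
      by transfer (simp add: F.scale_right_distrib)
    show "weyl_scale (c + d) p = weyl_scale c p + weyl_scale d p"
      by transfer (simp add: F.scale_left_distrib)
    show "weyl_scale c (weyl_scale d p) = weyl_scale (c * d) p"
      by transfer (simp only: F.scale_scale equivp_reflp[OF ideal_cong_equivp])
    show "weyl_scale 1 p = p"
      by transfer (simp only: F.scale_one equivp_reflp[OF ideal_cong_equivp])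
    show "weyl_scale c p * q = weyl_scale c (p * q)"
      by transfer (simp only: F.scale_mult_left equivp_reflp[OF ideal_cong_equivp])
    show "p * weyl_scale c q = weyl_scale c (p * q)"
      by transfer (simp only: F.scale_mult_right equivp_reflp[OF ideal_cong_equivp])
  qed
qed

lemma weyl_induct [case_names one add scale d t]:
  fixes r :: "'k::field weyl"
  assumes "P 1"
    and "\<And>a b. P a \<Longrightarrow> P b \<Longrightarrow> P (a + b)"
    and "\<And>c a. P a \<Longrightarrow> P (weyl_scale c a)"
    and "\<And>a. P a \<Longrightarrow> P (weyl_d * a)"
    and "\<And>a. P a \<Longrightarrow> P (weyl_t * a)"
  shows "P r"
proof (induction r rule: weyl.abs_induct)
  case (1 p)
  show ?case
  proof (induction p rule: free_algebra_word_induct)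
    case 1
    then show ?case
      using assms(1) by (simp add: one_weyl.abs_eq)
  next
    case (2 a b)
    then show ?case
      using assms(2) by (simp flip: plus_weyl.abs_eq)
  next
    case (3 c a)
    then show ?case
      using assms(3) by (simp flip: weyl_scale.abs_eq)
  next
    case (4 g a)
    then show ?case
      using assms(4,5)
      by (cases g) (simp_all flip: times_weyl.abs_eq weyl_d.abs_eq weyl_t.abs_eq)
  qed
qed

lemma super_jordan_induct [case_names one add scale x y]:
  fixes r :: "'k::field super_jordan"
  assumes "P 1"
    and "\<And>a b. P a \<Longrightarrow> P b \<Longrightarrow> P (a + b)"
    and "\<And>c a. P a \<Longrightarrow> P (sj_scale c a)"
    and "\<And>a. P a \<Longrightarrow> P (sj_x * a)"
    and "\<And>a. P a \<Longrightarrow> P (sj_y * a)"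
  shows "P r"
proof (induction r rule: super_jordan.abs_induct)
  case (1 p)
  show ?case
  proof (induction p rule: free_algebra_word_induct)
    case 1
    then show ?case
      using assms(1) by (simp add: one_super_jordan.abs_eq)
  next
    case (2 a b)
    then show ?case
      using assms(2) by (simp flip: plus_super_jordan.abs_eq)
  next
    case (3 c a)
    then show ?case
      using assms(3) by (simp flip: sj_scale.abs_eq)
  next
    case (4 g a)
    then show ?case
      using assms(4,5)
      by (cases g) (simp_all flip: times_super_jordan.abs_eq sj_x.abs_eq sj_y.abs_eq)
  qed
qed

text \<open>The universal property of the presentation. The free algebra acts on the target by left
  multiplication with \<open>d\<close> and \<open>t\<close>; the relation makes this action descend,
  and evaluation at \<open>1\<close> is the homomorphism.\<close>

lemma weyl_lift:
  fixes scl :: "'k::field \<Rightarrow> 'a::ring_1 \<Rightarrow> 'a"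
  assumes alg: "assoc_algebra scl" and rel: "d * t - t * d = 1"
  obtains f :: "'k weyl \<Rightarrow> 'a"
  where "algebra_hom weyl_scale scl f" "f weyl_d = d" "f weyl_t = t"
proof -
  interpret assoc_algebra scl
    by (rule alg)
  define \<alpha> :: "weyl_gen \<Rightarrow> 'a \<Rightarrow> 'a"
    where "\<alpha> g = (*) (case g of Weyl_d \<Rightarrow> d | Weyl_t \<Rightarrow> t)" for g
  interpret free_algebra_action scl \<alpha>
    by standard (simp_all add: \<alpha>_def distrib_left scale_mult_right scale_right_distrib scale_left_distrib)
  have rels: "act r v = 0" if "r \<in> weyl_rels" for r v
  proof -
    have "d * (t * v) - t * (d * v) - v = (d * t - t * d - 1) * v"
      by (simp add: algebra_simps)
    with that rel show ?thesis
      by (simp add: weyl_rels_def Let_def act_diff act_mult act_gen act_1 \<alpha>_def)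
  qed
  define f where "f r = act (rep_weyl r) 1" for r
  have f_abs: "f (abs_weyl p) = act p 1" for p
    unfolding f_def
    by (rule act_ideal_cong[OF rels Quotient3_rep_abs[OF Quotient3_weyl]])
      (simp_all add: equivp_reflp[OF ideal_cong_equivp])
  \<comment> \<open>Every element acts as left multiplication by its value at \<open>1\<close>; this
    turns composition of actions into products of values.\<close>
  have act_eq: "act p v = act p 1 * v" for p v
  proof -
    have "foldr \<alpha> ws v = foldr \<alpha> ws 1 * v" for ws
      by (induction ws) (simp_all add: \<alpha>_def mult.assoc)
    then have "scl c (foldr \<alpha> ws v) = scl c (foldr \<alpha> ws 1) * v" for c ws
      by (simp add: scale_mult_left)
    then show ?thesis
      by (simp add: act_def sum_distrib_right)
  qed
  have add: "f (a + b) = f a + f b" for a b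
    by (induction a rule: weyl.abs_induct, induction b rule: weyl.abs_induct)
      (simp add: f_abs plus_weyl.abs_eq act_add)
  have mult: "f (a * b) = f a * f b" for a b
  proof (induction a rule: weyl.abs_induct, induction b rule: weyl.abs_induct)
    case (1 q p)
    then show ?case
      using act_eq[of p "act q 1"] by (simp add: f_abs times_weyl.abs_eq act_mult)
  qed
  have scale: "f (weyl_scale c a) = scl c (f a)" for c a
    by (induction a rule: weyl.abs_induct)
      (simp add: f_abs weyl_scale.abs_eq act_mult act_scalar)
  have one: "f 1 = 1"
    by (simp add: one_weyl.abs_eq f_abs act_1)
  interpret W: assoc_algebra "weyl_scale :: 'k \<Rightarrow> _"
    by (rule assoc_algebra_weyl)
  show thesis
  proof
    have "module_hom weyl_scale scl f"
      by unfold_locales (simp_all add: add scale)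
    then show "algebra_hom weyl_scale scl f"
      using alg assoc_algebra_weyl by (simp add: algebra_hom_def mult one)
    show "f weyl_d = d" "f weyl_t = t"
      by (simp_all add: weyl_d.abs_eq weyl_t.abs_eq f_abs act_gen \<alpha>_def)
  qed
qed

text \<open>The counterpart of \<open>weyl_lift\<close> for modules: operators satisfying the two
  defining relations let the action of the free algebra descend. Speaking of actions avoids forming
  an endomorphism ring.\<close>

lemma super_jordan_module:
  fixes scl :: "'k::field \<Rightarrow> 'v::ab_group_add \<Rightarrow> 'v"
  assumes X: "module_hom scl scl X" and Y: "module_hom scl scl Y" and "vector_space scl"
    and XX: "\<And>v. X (X v) = 0"
    and YYX: "\<And>v. Y (Y (X v)) = X (Y (Y v)) + X (Y (X v))"
  obtains \<rho> :: "'k super_jordan \<Rightarrow> 'v \<Rightarrow> 'v"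
  where "\<And>v. \<rho> 0 v = 0" "\<And>v. \<rho> 1 v = v" "\<And>a b v. \<rho> (a + b) v = \<rho> a v + \<rho> b v"
    "\<And>c a v. \<rho> (sj_scale c a) v = scl c (\<rho> a v)"
    "\<And>a b v. \<rho> (a * b) v = \<rho> a (\<rho> b v)"
    "\<And>v. \<rho> sj_x v = X v" "\<And>v. \<rho> sj_y v = Y v"
proof -
  interpret vector_space scl
    by fact
  define \<alpha> where "\<alpha> g = (case g of SJ_x \<Rightarrow> X | SJ_y \<Rightarrow> Y)" for g
  have "module_hom scl scl (\<alpha> g)" for g
    by (cases g) (simp_all add: \<alpha>_def X Y)
  then interpret free_algebra_action scl \<alpha>
    by (intro free_algebra_action.intro free_algebra_action_axioms.intro vector_space_axioms)
  have rels: "act r v = 0" if "r \<in> sj_rels" for r v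
    using that
    by (auto simp: sj_rels_def Let_def power2_eq_square act_diff act_mult act_gen \<alpha>_def XX YYX)
  define \<rho> where "\<rho> r = act (rep_super_jordan r)" for r
  have \<rho>_abs: "\<rho> (abs_super_jordan p) v = act p v" for p v
    unfolding \<rho>_def
    by (rule act_ideal_cong[OF rels Quotient3_rep_abs[OF Quotient3_super_jordan]])
      (simp_all add: equivp_reflp[OF ideal_cong_equivp])
  show thesis
  proof
    fix a b :: "'k super_jordan" and c :: 'k and v :: 'v
    show "\<rho> (a + b) v = \<rho> a v + \<rho> b v"
      by (induction a rule: super_jordan.abs_induct, induction b rule: super_jordan.abs_induct)
        (simp add: \<rho>_abs plus_super_jordan.abs_eq act_add)
    show "\<rho> (a * b) v = \<rho> a (\<rho> b v)"
      by (induction a rule: super_jordan.abs_induct, induction b rule: super_jordan.abs_induct)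
        (simp add: \<rho>_abs times_super_jordan.abs_eq act_mult)
    show "\<rho> (sj_scale c a) v = scl c (\<rho> a v)"
      by (induction a rule: super_jordan.abs_induct)
        (simp add: \<rho>_abs sj_scale.abs_eq act_mult act_scalar)
    show "\<rho> 0 v = 0" "\<rho> 1 v = v" "\<rho> sj_x v = X v" "\<rho> sj_y v = Y v"
      by (simp_all add: zero_super_jordan.abs_eq one_super_jordan.abs_eq sj_x.abs_eq sj_y.abs_eq
          \<rho>_abs act_0 act_1 act_gen \<alpha>_def)
  qed
qed


section \<open>Matrix units\<close>

locale matrix_units =
  fixes e :: "'n::finite \<Rightarrow> 'n \<Rightarrow> 'a::ring_1"
  assumes unit_mult: "e i j * e k l = (if j = k then e i l else 0)"
    and unit_sum: "(\<Sum>i\<in>UNIV. e i i) = 1"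
begin

text \<open>Summing over \<open>k\<close> makes each entry commute with all units: multiplying by
  \<open>e p q\<close> on either side leaves \<open>e p i * a * e j q\<close>.\<close>

definition to_matrix :: "'a \<Rightarrow> 'a^'n^'n" where
  "to_matrix a = (\<chi> i j. \<Sum>k\<in>UNIV. e k i * a * e j k)"

definition of_matrix :: "'a^'n^'n \<Rightarrow> 'a" where
  "of_matrix M = (\<Sum>i\<in>UNIV. \<Sum>j\<in>UNIV. M $ i $ j * e i j)"

lemma unit_mult_assoc: "e i j * (e k l * a) = (if j = k then e i l * a else 0)"
  by (simp add: unit_mult flip: mult.assoc)

lemma to_matrix_add: "to_matrix (a + b) = to_matrix a + to_matrix b"
  by (simp add: to_matrix_def vec_eq_iff algebra_simps sum.distrib)

lemma to_matrix_one: "to_matrix 1 = mat 1"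
  by (simp add: to_matrix_def vec_eq_iff mat_def unit_mult unit_sum)

text \<open>In a product of two entries the inner units \<open>e l k * e m l\<close> survive only
  for \<open>k = m\<close>, where they give \<open>e l l\<close>. Summed over \<open>l\<close>,
  these are \<open>1\<close>.\<close>

lemma to_matrix_mult: "to_matrix (a * b) = to_matrix a ** to_matrix b"
proof -
  have "(\<Sum>l\<in>UNIV. (\<Sum>k\<in>UNIV. e k i * a * e l k) * (\<Sum>m\<in>UNIV. e m l * b * e j m))
      = (\<Sum>k\<in>UNIV. e k i * (a * b) * e j k)" for i j
  proof -
    have "(\<Sum>k\<in>UNIV. e k i * a * e l k) * (\<Sum>m\<in>UNIV. e m l * b * e j m)
        = (\<Sum>k\<in>UNIV. e k i * a * (e l l * (b * e j k)))" for l
      by (simp add: sum_product mult.assoc unit_mult_assoc if_distrib[of "\<lambda>x. _ * x"] cong: if_cong)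
    then have "(\<Sum>l\<in>UNIV. (\<Sum>k\<in>UNIV. e k i * a * e l k) * (\<Sum>m\<in>UNIV. e m l * b * e j m))
        = (\<Sum>k\<in>UNIV. \<Sum>l\<in>UNIV. e k i * a * (e l l * (b * e j k)))"
      by (simp only:) (rule sum.swap)
    also have "\<dots> = (\<Sum>k\<in>UNIV. e k i * a * ((\<Sum>l\<in>UNIV. e l l) * (b * e j k)))"
      by (simp add: sum_distrib_left sum_distrib_right)
    finally show ?thesis
      by (simp add: unit_sum mult.assoc)
  qed
  then show ?thesis
    by (simp add: to_matrix_def matrix_matrix_mult_def)
qed

text \<open>The entry at \<open>i\<close>, \<open>j\<close> times \<open>e i j\<close> is
  \<open>e i i * a * e j j\<close>, so this is the Peirce decomposition of \<open>a\<close>.\<close>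

lemma of_matrix_to_matrix: "of_matrix (to_matrix a) = a"
proof -
  have "of_matrix (to_matrix a) = (\<Sum>i\<in>UNIV. \<Sum>j\<in>UNIV. e i i * a * e j j)"
    unfolding of_matrix_def
    by (simp add: to_matrix_def sum_distrib_right mult.assoc unit_mult
        if_distrib[of "\<lambda>x. _ * x"] cong: if_cong)
  also have "\<dots> = (\<Sum>i\<in>UNIV. e i i) * a * (\<Sum>j\<in>UNIV. e j j)"
    by (subst sum.swap) (simp add: sum_distrib_left sum_distrib_right mult.assoc)
  finally show ?thesis
    by (simp add: unit_sum)
qed

text \<open>Entries that commute with the units can be pulled out in front, and
  \<open>e k i * e l m * e j k\<close> is nonzero at most for \<open>l = i\<close> and
  \<open>m = j\<close>, where it is \<open>e k k\<close>.\<close>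

lemma to_matrix_of_matrix:
  assumes "\<And>i j k l. M $ i $ j * e k l = e k l * M $ i $ j"
  shows "to_matrix (of_matrix M) = M"
proof -
  have "e k i * (M $ l $ m * e l m) * e j k = (if m = j then if i = l then M $ i $ j * e k k else 0 else 0)"
    for i j k l m
  proof -
    have "e k i * (M $ l $ m * e l m) * e j k = M $ l $ m * (e k i * (e l m * e j k))"
      using assms[of l m k i] by (metis mult.assoc)
    then show ?thesis
      by (auto simp: unit_mult)
  qed
  then have "(\<Sum>k\<in>UNIV. e k i * of_matrix M * e j k) = (\<Sum>k\<in>UNIV. M $ i $ j * e k k)" for i j
    by (simp add: of_matrix_def sum_distrib_left sum_distrib_right)
  then show ?thesis
    by (simp add: to_matrix_def vec_eq_iff unit_sum flip: sum_distrib_left)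
qed

end


section \<open>Subalgebras\<close>

lemma (in assoc_algebra) subalgebraI:
  assumes "1 \<in> B" and "\<And>a b. a \<in> B \<Longrightarrow> b \<in> B \<Longrightarrow> a + b \<in> B"
    and "\<And>c a. a \<in> B \<Longrightarrow> scl c a \<in> B" and "\<And>a b. a \<in> B \<Longrightarrow> b \<in> B \<Longrightarrow> a * b \<in> B"
  shows "subalgebra scl B"
proof -
  have "0 \<in> B"
    using assms(3)[OF assms(1), of 0] by simp
  with assms show ?thesis
    by (simp add: subalgebra_def subspace_def)
qed

context assoc_algebra
begin

lemma subalgebra_one: "subalgebra scl B \<Longrightarrow> 1 \<in> B"
  and subalgebra_zero: "subalgebra scl B \<Longrightarrow> 0 \<in> B"
  and subalgebra_add: "subalgebra scl B \<Longrightarrow> a \<in> B \<Longrightarrow> b \<in> B \<Longrightarrow> a + b \<in> B"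
  and subalgebra_scale: "subalgebra scl B \<Longrightarrow> a \<in> B \<Longrightarrow> scl c a \<in> B"
  and subalgebra_mult: "subalgebra scl B \<Longrightarrow> a \<in> B \<Longrightarrow> b \<in> B \<Longrightarrow> a * b \<in> B"
  by (simp_all add: subalgebra_def subspace_def)

lemma subalgebra_power: "subalgebra scl B \<Longrightarrow> a \<in> B \<Longrightarrow> a ^ n \<in> B"
  by (induction n) (simp_all add: subalgebra_one subalgebra_mult)

lemma subalgebra_hull: "subalgebra scl (subalgebra scl hull G)"
  by (rule hull_in) (simp add: subalgebra_def subspace_def)

lemma subalgebra_centralizer: "subalgebra scl {a. \<forall>b\<in>E. a * b = b * a}"
  by (rule subalgebraI)
    (auto simp: algebra_simps scale_mult_left scale_mult_right, metis mult.assoc)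

end


section \<open>Ore conditions\<close>

text \<open>Differentiating a power of \<open>t\<close> lowers its exponent by one, so one extra
  factor \<open>t\<close> pays for moving \<open>d\<close> across. Explicitly, \<open>w\<close> is
  \<open>t d + n + 1\<close>.\<close>

lemma weyl_d_power_t: "\<exists>w. weyl_d * weyl_t ^ Suc n = weyl_t ^ n * (w :: 'k::field weyl)"
proof (induction n)
  case 0
  show ?case
    by (rule exI[of _ "weyl_d * weyl_t"]) simp
next
  case (Suc n)
  then obtain w :: "'k weyl" where w: "weyl_d * weyl_t ^ Suc n = weyl_t ^ n * w"
    by blast
  have "weyl_d * weyl_t ^ Suc (Suc n) = (weyl_d * weyl_t) * (weyl_t ^ Suc n :: 'k weyl)"
    by (simp add: mult.assoc)
  also have "\<dots> = weyl_t * (weyl_d * weyl_t ^ Suc n) + weyl_t ^ Suc n"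
    by (simp only: weyl_commutator distrib_right mult.assoc mult_1_left)
  also have "\<dots> = weyl_t ^ Suc n * (w + 1)"
    by (simp only: w) (simp add: algebra_simps)
  finally show ?case
    by blast
qed

text \<open>The right Ore condition for the powers of \<open>t\<close>. It lets a denominator be
  moved past a numerator when fractions are multiplied.\<close>

lemma weyl_Ore: "\<exists>N r'. r * weyl_t ^ N = weyl_t ^ n * (r' :: 'k::field weyl)"
proof (induction r arbitrary: n rule: weyl_induct)
  case one
  show ?case
    by (intro exI[of _ n] exI[of _ 1]) simp
next
  case (add a b)
  obtain N a' where a: "a * weyl_t ^ N = weyl_t ^ n * a'"
    using add.IH(1) by blast
  obtain M b' where b: "b * weyl_t ^ M = weyl_t ^ n * b'"
    using add.IH(2) by blast
  have "(a + b) * weyl_t ^ (N + M) = a * weyl_t ^ N * weyl_t ^ M + b * weyl_t ^ M * weyl_t ^ N"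
    by (simp add: distrib_right mult.assoc add.commute flip: power_add)
  also have "\<dots> = weyl_t ^ n * (a' * weyl_t ^ M + b' * weyl_t ^ N)"
    unfolding a b by (simp add: distrib_left mult.assoc)
  finally show ?case
    by blast
next
  case (scale c a)
  interpret assoc_algebra "weyl_scale :: 'k \<Rightarrow> _"
    by (rule assoc_algebra_weyl)
  obtain N a' where "a * weyl_t ^ N = weyl_t ^ n * a'"
    using scale.IH by blast
  then have "weyl_scale c a * weyl_t ^ N = weyl_t ^ n * weyl_scale c a'"
    by (simp add: scale_mult_left scale_mult_right)
  then show ?case
    by blast
next
  case (d a)
  \<comment> \<open>The hypothesis is taken at \<open>Suc n\<close> because \<open>d\<close> uses up
    one power of \<open>t\<close>; hence the induction over arbitrary \<open>n\<close>.\<close>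
  obtain N a' where a: "a * weyl_t ^ N = weyl_t ^ Suc n * a'"
    using d.IH by blast
  obtain w :: "'k weyl" where w: "weyl_d * weyl_t ^ Suc n = weyl_t ^ n * w"
    using weyl_d_power_t by blast
  have "weyl_d * a * weyl_t ^ N = weyl_d * weyl_t ^ Suc n * a'"
    by (simp only: a mult.assoc)
  also have "\<dots> = weyl_t ^ n * (w * a')"
    by (simp only: w mult.assoc)
  finally show ?case
    by blast
next
  case (t a)
  obtain N a' where a: "a * weyl_t ^ N = weyl_t ^ n * a'"
    using t.IH by blast
  have "weyl_t * a * weyl_t ^ N = weyl_t ^ n * (weyl_t * a')"
    by (simp add: a mult.assoc) (simp flip: mult.assoc power_Suc power_Suc2)
  then show ?case
    by blast
qed

section \<open>Normality of \<open>s\<close> in the super Jordan plane\<close>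

lemma sj_s_x: "sj_s * sj_x = sj_x * (sj_s :: 'k::field super_jordan)"
  by (simp add: sj_s_def distrib_left distrib_right mult.assoc sj_x_square)
    (simp add: sj_x_square flip: mult.assoc)

text \<open>After expansion and \<open>x^2 = 0\<close>, this is the second defining relation with
  \<open>y x y\<close> added to both sides.\<close>

lemma sj_y_s: "sj_y * sj_s = sj_s * (sj_y + (sj_x :: 'k::field super_jordan))"
  by (simp add: sj_s_def distrib_left distrib_right mult.assoc sj_x_square sj_relation)

text \<open>The generators can be moved across \<open>s\<close> one at a time. The assumption on
  scalars is supplied later by the localization map, which is an algebra homomorphism.\<close>

lemma sj_s_normal:
  assumes "assoc_algebra (sj_scale :: 'k::field \<Rightarrow> _)"
  shows "\<exists>r'. r * sj_s = sj_s * (r' :: 'k super_jordan)"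
proof (induction r rule: super_jordan_induct)
  case one
  show ?case
    by (intro exI[of _ 1]) simp
next
  case (add a b)
  then show ?case
    by (metis distrib_left distrib_right)
next
  case (scale c a)
  then show ?case
    by (metis assms assoc_algebra.scale_mult_left assoc_algebra.scale_mult_right)
next
  case (x a)
  then show ?case
    by (metis mult.assoc sj_s_x)
next
  case (y a)
  then show ?case
    by (metis mult.assoc sj_y_s)
qed


section \<open>The localized super Jordan plane\<close>

text \<open>
  The matrices of the theorem with \<open>y'^2\<close> and \<open>s\<close> replaced by the abstract generators \<open>\<partial>\<close> and \<open>t\<close>,
  acting on columns over the Weyl algebra: \<open>y = y' s\<close> becomes \<open>(0 1; \<partial> 0) t\<close>.
\<close>

lemma super_jordan_weyl_module:
  obtains \<rho> :: "'k::field super_jordan \<Rightarrow> 'k weyl \<times> 'k weyl \<Rightarrow> 'k weyl \<times> 'k weyl"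
  where "\<And>w. \<rho> 0 w = 0" "\<And>w. \<rho> 1 w = w" "\<And>a b w. \<rho> (a + b) w = \<rho> a w + \<rho> b w"
    "\<And>c a u v. \<rho> (sj_scale c a) (u, v)
        = (weyl_scale c (fst (\<rho> a (u, v))), weyl_scale c (snd (\<rho> a (u, v))))"
    "\<And>a b w. \<rho> (a * b) w = \<rho> a (\<rho> b w)"
    "\<And>u v. \<rho> sj_x (u, v) = (0, u)"
    "\<And>u v. \<rho> sj_y (u, v) = (weyl_t * v, weyl_d * (weyl_t * u))"
    "\<And>n u v. \<rho> (sj_s ^ n) (u, v) = (weyl_t ^ n * u, weyl_t ^ n * v)"
proof -
  interpret W: assoc_algebra "weyl_scale :: 'k \<Rightarrow> _"
    by (rule assoc_algebra_weyl)
  define scl :: "'k \<Rightarrow> 'k weyl \<times> 'k weyl \<Rightarrow> 'k weyl \<times> 'k weyl"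
    where "scl c w = (weyl_scale c (fst w), weyl_scale c (snd w))" for c w
  define X :: "'k weyl \<times> 'k weyl \<Rightarrow> 'k weyl \<times> 'k weyl" where "X w = (0, fst w)" for w
  define Y :: "'k weyl \<times> 'k weyl \<Rightarrow> 'k weyl \<times> 'k weyl"
    where "Y w = (weyl_t * snd w, weyl_d * (weyl_t * fst w))" for w
  interpret V: vector_space scl
    by unfold_locales (simp_all add: scl_def W.scale_right_distrib W.scale_left_distrib)
  have X: "module_hom scl scl X"
    by unfold_locales (simp_all add: scl_def X_def)
  have Y: "module_hom scl scl Y"
    by unfold_locales (simp_all add: scl_def Y_def distrib_left W.scale_mult_right)
  have XX: "X (X w) = 0" for w
    by (simp add: X_def zero_prod_def)
  \<comment> \<open>For \<open>w = (u, v)\<close> the first components vanish, and the second ones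
    are the Weyl relation applied to \<open>t u\<close>.\<close>
  have YYX: "Y (Y (X w)) = X (Y (Y w)) + X (Y (X w))" for w
    by (simp add: X_def Y_def weyl_commutator_assoc distrib_left)
  obtain \<rho> :: "'k super_jordan \<Rightarrow> 'k weyl \<times> 'k weyl \<Rightarrow> 'k weyl \<times> 'k weyl"
    where \<rho>: "\<And>w. \<rho> 0 w = 0" "\<And>w. \<rho> 1 w = w" "\<And>a b w. \<rho> (a + b) w = \<rho> a w + \<rho> b w"
    "\<And>c a w. \<rho> (sj_scale c a) w = scl c (\<rho> a w)"
    "\<And>a b w. \<rho> (a * b) w = \<rho> a (\<rho> b w)"
    "\<And>w. \<rho> sj_x w = X w" "\<And>w. \<rho> sj_y w = Y w"
    by (rule super_jordan_module[OF X Y V.vector_space_axioms XX YYX]) (rule that; assumption)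
  \<comment> \<open>Here \<open>y x\<close> contributes the first component and \<open>x y\<close>
    the second.\<close>
  have s: "\<rho> sj_s (u, v) = (weyl_t * u, weyl_t * v)" for u v
    by (simp add: sj_s_def \<rho> X_def Y_def)
  have "\<rho> (sj_s ^ n) (u, v) = (weyl_t ^ n * u, weyl_t ^ n * v)" for n u v
    by (induction n) (simp_all add: \<rho> s mult.assoc)
  with \<rho> show thesis
    by (intro that[of \<rho>]) (simp_all add: scl_def X_def Y_def)
qed

locale sj_localization =
  fixes scl :: "'k::field \<Rightarrow> 'l::ring_1 \<Rightarrow> 'l" and \<iota> :: "'k super_jordan \<Rightarrow> 'l" and s_inv :: 'l
  assumes localization: "is_localization sj_scale scl \<iota> {sj_s ^ n | n. True} UNIV"
    and s_s_inv: "\<iota> sj_s * s_inv = 1" and s_inv_s: "s_inv * \<iota> sj_s = 1"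
begin

definition "x = \<iota> sj_x"
definition "s = \<iota> sj_s"
definition "y' = \<iota> sj_y * s_inv"
definition "A = subalgebra scl hull {y'^2, s, s_inv}"

lemma hom: "algebra_hom sj_scale scl \<iota>"
  using localization by (simp add: is_localization_def)

sublocale assoc_algebra scl
  using hom by (simp add: algebra_hom_def)

lemma
  shows \<iota>_mult: "\<iota> (a * b) = \<iota> a * \<iota> b" and \<iota>_one: "\<iota> 1 = 1"
    and \<iota>_add: "\<iota> (a + b) = \<iota> a + \<iota> b" and \<iota>_scale: "\<iota> (sj_scale c a) = scl c (\<iota> a)"
    and \<iota>_zero: "\<iota> 0 = 0"
  using hom by (auto simp: algebra_hom_def module_hom.add module_hom.scale module_hom.zero)

lemma \<iota>_power: "\<iota> (a ^ n) = \<iota> a ^ n"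
  by (induction n) (simp_all add: \<iota>_mult \<iota>_one)

lemma inverse_s: "s * s_inv = 1" "s_inv * s = 1"
  using s_s_inv s_inv_s by (simp_all add: s_def)

lemma inverse_s_assoc: "s * (s_inv * a) = a" "s_inv * (s * a) = a"
  by (simp_all add: inverse_s flip: mult.assoc)

lemma s_power_inverse: "s ^ n * s_inv ^ n = 1" "s_inv ^ n * s ^ n = 1"
  by (simp_all add: inverse_s left_right_inverse_power)

lemma \<iota>_y: "\<iota> sj_y = y' * s"
  by (simp add: y'_def mult.assoc inverse_s)

section \<open>Relations between \<open>x\<close>, \<open>y'\<close> and \<open>s\<close> in the
  localization\<close>

lemma x_x: "x * x = 0"
  by (simp add: x_def sj_x_square \<iota>_zero flip: \<iota>_mult)

lemma s_x: "s * x = x * s"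
  by (simp add: x_def s_def sj_s_x flip: \<iota>_mult)

text \<open>This is \<open>sj_y_s\<close> with \<open>y = y' s\<close>, after cancelling
  \<open>s\<close> on the right.\<close>

lemma s_y': "s * y' = y' * s - x"
proof -
  have "y' * s * s = s * (y' * s + x)"
    using arg_cong[OF sj_y_s, of \<iota>] by (simp add: \<iota>_mult \<iota>_add \<iota>_y x_def s_def)
  then have "s * y' * s = (y' * s - x) * s"
    by (simp add: algebra_simps s_x)
  then show ?thesis
    by (metis inverse_s(1) mult.assoc mult.right_neutral)
qed

lemma x_y': "x * y' + y' * x = 1"
proof -
  have "s = x * \<iota> sj_y + \<iota> sj_y * x"
    by (simp add: s_def sj_s_def \<iota>_add \<iota>_mult x_def)
  also have "\<dots> = (x * y' + y' * x) * s"
    by (simp add: \<iota>_y distrib_right mult.assoc s_x)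
  finally show ?thesis
    by (metis inverse_s(1) mult.assoc mult.right_neutral)
qed

text \<open>Moving \<open>s\<close> across each of the two factors \<open>y'\<close> costs a term
  with \<open>x\<close>; the two corrections add up to \<open>x y' + y' x = 1\<close>.\<close>

lemma commutator: "y'^2 * s = s * y'^2 + 1"
proof -
  have "s * (y' * y') = (y' * s - x) * y'"
    by (simp only: s_y' flip: mult.assoc)
  also have "\<dots> = y' * (y' * s - x) - x * y'"
    by (simp add: left_diff_distrib mult.assoc s_y')
  also have "\<dots> = y' * y' * s - (x * y' + y' * x)"
    by (simp add: algebra_simps)
  finally show ?thesis
    by (simp add: x_y' power2_eq_square)
qed

text \<open>Applying \<open>x y' = 1 - y' x\<close> twice restores the sign, and the two terms
  \<open>y'\<close> cancel.\<close>

lemma x_y'_square: "x * y'^2 = y'^2 * x"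
proof -
  have xy: "x * y' = 1 - y' * x"
    using x_y' by (simp add: eq_diff_eq)
  have "x * y' * y' = y' - y' * (x * y')"
    unfolding xy by (simp add: left_diff_distrib mult.assoc xy)
  also have "\<dots> = y' * y' * x"
    unfolding xy by (simp add: right_diff_distrib mult.assoc)
  finally show ?thesis
    by (simp add: power2_eq_square mult.assoc)
qed

section \<open>The subalgebra \<open>A\<close> and generators of the localization\<close>

lemma subalgebra_A: "subalgebra scl A"
  unfolding A_def by (rule subalgebra_hull)

lemma A_gens: "y'^2 \<in> A" "s \<in> A" "s_inv \<in> A"
  unfolding A_def by (simp_all add: hull_inc)

lemma A_subset: "subalgebra scl B \<Longrightarrow> y'^2 \<in> B \<Longrightarrow> s \<in> B \<Longrightarrow> s_inv \<in> B \<Longrightarrow> A \<subseteq> B"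
  unfolding A_def by (rule hull_minimal) auto

text \<open>Since \<open>y = y' s\<close>, \<open>B\<close> contains the image of the super Jordan
  plane, and every element is such an image times a power of \<open>s_inv\<close>.\<close>

lemma in_generated:
  assumes B: "subalgebra scl B" and gens: "x \<in> B" "y' \<in> B" "s \<in> B" "s_inv \<in> B"
  shows "a \<in> B"
proof -
  have \<iota>: "\<iota> r \<in> B" for r
    by (induction r rule: super_jordan_induct)
      (use B gens in \<open>simp_all add: \<iota>_one \<iota>_add \<iota>_scale \<iota>_mult \<iota>_y subalgebra_one
         subalgebra_add subalgebra_scale subalgebra_mult flip: x_def\<close>)
  obtain r t where t: "a * \<iota> t = \<iota> r" "t \<in> {sj_s ^ n | n. True}"
    using localization unfolding is_localization_def by blast
  then obtain n where "t = sj_s ^ n"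
    by blast
  with t(1) have "a * s ^ n = \<iota> r"
    by (simp add: \<iota>_power s_def)
  then have "a = \<iota> r * s_inv ^ n"
    by (metis mult.assoc mult.right_neutral s_power_inverse(1))
  then show ?thesis
    using B gens \<iota> by (simp add: subalgebra_mult subalgebra_power)
qed


subsection \<open>The Weyl algebra\<close>

lemma weyl_localization:
  "\<exists>S (f :: 'k weyl \<Rightarrow> 'l). is_localization weyl_scale scl f S A"
proof -
  obtain f :: "'k weyl \<Rightarrow> 'l"
    where f: "algebra_hom weyl_scale scl f" "f weyl_d = y'^2" "f weyl_t = s"
    using weyl_lift[OF assoc_algebra_axioms, of "y'^2" s] commutator by auto
  have f_simps: "f (a * b) = f a * f b" "f 1 = 1" "f (a + b) = f a + f b"
      "f (weyl_scale c a) = scl c (f a)" "f 0 = 0" for a b c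
    using f(1) by (auto simp: algebra_hom_def module_hom.add module_hom.scale module_hom.zero)
  have f_power: "f (weyl_t ^ n) = s ^ n" for n
    by (induction n) (simp_all add: f_simps f)
  have f_A: "f r \<in> A" for r
    by (induction r rule: weyl_induct)
      (use subalgebra_A A_gens in \<open>simp_all add: f_simps f subalgebra_one subalgebra_add
         subalgebra_scale subalgebra_mult\<close>)
  interpret W: assoc_algebra "weyl_scale :: 'k \<Rightarrow> _"
    by (rule assoc_algebra_weyl)

  have fraction: "\<exists>r n. a * s ^ n = f r" if "a \<in> A" for a
  proof -
    \<comment> \<open>The right fractions over the image of the Weyl algebra. They contain the
      generators of \<open>A\<close>, so it suffices that they form a subalgebra.\<close>
    let ?B = "{a. \<exists>r n. a * s ^ n = f r}"
    have "subalgebra scl ?B"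
    proof (rule subalgebraI)
      have "1 * s ^ 0 = f 1"
        by (simp add: f_simps)
      then show "1 \<in> ?B"
        by blast
    next
      fix a b assume "a \<in> ?B" "b \<in> ?B"
      then obtain r n r' m where r: "a * s ^ n = f r" and r': "b * s ^ m = f r'"
        by auto
      have "(a + b) * s ^ (n + m) = a * s ^ n * s ^ m + b * s ^ m * s ^ n"
        by (simp add: distrib_right mult.assoc add.commute flip: power_add)
      also have "\<dots> = f (r * weyl_t ^ m + r' * weyl_t ^ n)"
        by (simp add: r r' f_simps f_power)
      finally show "a + b \<in> ?B"
        by blast
      \<comment> \<open>In \<open>a b\<close> the denominator of \<open>a\<close> stands left of the
        numerator \<open>r'\<close> of \<open>b\<close>; the Ore condition produces the factor
        \<open>s ^ n\<close> that cancels it.\<close>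
      obtain N r'' where r'': "r' * weyl_t ^ N = weyl_t ^ n * r''"
        using weyl_Ore by blast
      have "a * b * s ^ (m + N) = a * (b * s ^ m) * s ^ N"
        by (simp add: mult.assoc power_add)
      also have "\<dots> = a * f (r' * weyl_t ^ N)"
        by (simp add: r' f_simps f_power mult.assoc)
      also have "\<dots> = f (r * r'')"
        by (simp add: r'' f_simps f_power flip: r mult.assoc)
      finally show "a * b \<in> ?B"
        by blast
    next
      fix c a assume "a \<in> ?B"
      then obtain r n where "a * s ^ n = f r"
        by blast
      then have "scl c a * s ^ n = f (weyl_scale c r)"
        by (simp add: scale_mult_left f_simps)
      then show "scl c a \<in> ?B"
        by blast
    qed
    moreover have "y'^2 * s ^ 0 = f weyl_d" "s * s ^ 0 = f weyl_t" "s_inv * s ^ 1 = f 1"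
      by (simp_all add: f f_simps inverse_s)
    then have "y'^2 \<in> ?B" "s \<in> ?B" "s_inv \<in> ?B"
      by blast+
    ultimately have "A \<subseteq> ?B"
      by (rule A_subset)
    with that show ?thesis
      by blast
  qed

  have torsion: "\<exists>n. r * weyl_t ^ n = 0" if "f r = 0" for r
  proof -
    obtain \<rho> :: "'k super_jordan \<Rightarrow> 'k weyl \<times> 'k weyl \<Rightarrow> 'k weyl \<times> 'k weyl"
      where \<rho>: "\<And>w. \<rho> 0 w = 0" "\<And>w. \<rho> 1 w = w" "\<And>a b w. \<rho> (a + b) w = \<rho> a w + \<rho> b w"
      "\<And>c a u v. \<rho> (sj_scale c a) (u, v)
          = (weyl_scale c (fst (\<rho> a (u, v))), weyl_scale c (snd (\<rho> a (u, v))))"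
      "\<And>a b w. \<rho> (a * b) w = \<rho> a (\<rho> b w)"
      "\<And>u v. \<rho> sj_x (u, v) = (0, u)"
      "\<And>u v. \<rho> sj_y (u, v) = (weyl_t * v, weyl_d * (weyl_t * u))"
      "\<And>n u v. \<rho> (sj_s ^ n) (u, v) = (weyl_t ^ n * u, weyl_t ^ n * v)"
      by (rule super_jordan_weyl_module) (rule that; assumption)
    note \<rho>_s = \<rho>(8)[of 1, simplified]
    \<comment> \<open>The action of the lift is carried through the induction, because
      \<open>r'\<close> is chosen anew in each case.\<close>
    have lift: "\<exists>N r'. f r * s ^ N = \<iota> r' \<and>
        (\<forall>u v. \<rho> r' (u, v) = (r * weyl_t ^ N * u, r * weyl_t ^ N * v))" for r
    proof (induction r rule: weyl_induct)
      case one
      show ?case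
        by (intro exI[of _ 0] exI[of _ 1]) (simp add: f_simps \<iota>_one \<rho>)
    next
      case (add a b)
      obtain N a' where a: "f a * s ^ N = \<iota> a'"
        "\<And>u v. \<rho> a' (u, v) = (a * weyl_t ^ N * u, a * weyl_t ^ N * v)"
        using add.IH(1) by blast
      obtain M b' where b: "f b * s ^ M = \<iota> b'"
        "\<And>u v. \<rho> b' (u, v) = (b * weyl_t ^ M * u, b * weyl_t ^ M * v)"
        using add.IH(2) by blast
      have comm: "z ^ M * (z ^ N * u) = z ^ N * (z ^ M * u)" for z u :: "'k weyl"
        by (simp add: add.commute flip: mult.assoc power_add)
      have "f (a + b) * s ^ (N + M) = f a * s ^ N * s ^ M + f b * s ^ M * s ^ N"
        by (simp add: f_simps distrib_right mult.assoc add.commute flip: power_add)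
      also have "\<dots> = \<iota> (a' * sj_s ^ M + b' * sj_s ^ N)"
        unfolding a b by (simp add: \<iota>_add \<iota>_mult \<iota>_power s_def)
      finally show ?case
        by (intro exI[of _ "N + M"] exI[of _ "a' * sj_s ^ M + b' * sj_s ^ N"])
          (simp add: \<rho> a b distrib_right mult.assoc power_add comm)
    next
      case (scale c a)
      then obtain N a' where a: "f a * s ^ N = \<iota> a'"
        "\<And>u v. \<rho> a' (u, v) = (a * weyl_t ^ N * u, a * weyl_t ^ N * v)"
        by blast
      then show ?case
        by (intro exI[of _ N] exI[of _ "sj_scale c a'"])
          (simp add: f_simps \<iota>_scale \<rho> scale_mult_left W.scale_mult_left)
    next
      case (t a)
      then obtain N a' where a: "f a * s ^ N = \<iota> a'"
        "\<And>u v. \<rho> a' (u, v) = (a * weyl_t ^ N * u, a * weyl_t ^ N * v)"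
        by blast
      then show ?case
        by (intro exI[of _ N] exI[of _ "sj_s * a'"])
          (simp add: f f_simps \<iota>_mult \<rho> \<rho>_s mult.assoc flip: s_def)
    next
      case (d a)
      then obtain N a' where a: "f a * s ^ N = \<iota> a'"
        "\<And>u v. \<rho> a' (u, v) = (a * weyl_t ^ N * u, a * weyl_t ^ N * v)"
        by blast
      have normal: "\<exists>r'. r * sj_s = sj_s * r'" for r :: "'k super_jordan"
        using hom by (intro sj_s_normal) (simp add: algebra_hom_def)
      \<comment> \<open>Normality is used twice to bring \<open>s^2\<close>, the denominator of
        \<open>y'^2\<close>, to the left of the lift.\<close>
      then obtain b where b: "a' * sj_s * sj_s = sj_s * (sj_s * b)"
        by (metis mult.assoc)
      let ?q = "sj_y * ((sj_y + sj_x) * b)"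
      \<comment> \<open>Clears the denominator of \<open>y'^2\<close>: it equals \<open>y (y + x) s\<^sup>-\<^sup>2\<close>.\<close>
      have y_square: "y'^2 * (s * s) = \<iota> (sj_y * (sj_y + sj_x))"
      proof -
        have "y' * s * s = s * \<iota> (sj_y + sj_x)"
          using arg_cong[OF sj_y_s, of \<iota>] by (simp add: \<iota>_mult \<iota>_y s_def)
        then show ?thesis
          by (simp add: power2_eq_square mult.assoc \<iota>_mult \<iota>_y)
      qed
      have "f (weyl_d * a) * s ^ (N + 2) = y'^2 * (f a * s ^ N * s * s)"
        by (simp only: f f_simps mult.assoc power_add power2_eq_square[of s])
      also have "\<dots> = y'^2 * \<iota> (a' * sj_s * sj_s)"
        unfolding a by (simp add: \<iota>_mult s_def)
      also have "\<dots> = y'^2 * (s * s) * \<iota> b"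
        unfolding b by (simp add: \<iota>_mult s_def mult.assoc)
      also have "\<dots> = \<iota> ?q"
        by (simp add: y_square \<iota>_mult mult.assoc)
      finally have "f (weyl_d * a) * s ^ (N + 2) = \<iota> ?q" .
      moreover have "\<rho> ?q (u, v)
          = (weyl_d * a * weyl_t ^ (N + 2) * u, weyl_d * a * weyl_t ^ (N + 2) * v)" for u v
      proof -
        obtain u' v' where uv: "\<rho> b (u, v) = (u', v')"
          by fastforce
        \<comment> \<open>The action of \<open>b\<close> is known only after multiplication by
          \<open>s^2\<close>, that is, through \<open>t t u'\<close> and \<open>t t v'\<close>. This
          is enough, since \<open>?q\<close> sends \<open>(u, v)\<close> to \<open>d\<close> times
          these.\<close>
        have "\<rho> (sj_s * (sj_s * b)) (u, v) = \<rho> (a' * sj_s * sj_s) (u, v)"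
          by (simp only: b)
        then have "weyl_t * (weyl_t * u') = a * (weyl_t ^ N * (weyl_t * (weyl_t * u)))"
          "weyl_t * (weyl_t * v') = a * (weyl_t ^ N * (weyl_t * (weyl_t * v)))"
          by (simp_all add: \<rho> \<rho>_s uv a mult.assoc)
        then have eq: "weyl_t * (weyl_t * u') = a * weyl_t ^ (N + 2) * u"
          "weyl_t * (weyl_t * v') = a * weyl_t ^ (N + 2) * v"
          by (simp_all only: mult.assoc power_add power2_eq_square)
        have "weyl_t * (weyl_d * (weyl_t * u')) + weyl_t * u' = weyl_d * (weyl_t * (weyl_t * u'))"
          by (simp add: weyl_commutator_assoc)
        then have "\<rho> ?q (u, v)
            = (weyl_d * (weyl_t * (weyl_t * u')), weyl_d * (weyl_t * (weyl_t * v')))"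
          by (simp add: \<rho> uv distrib_left)
        then show ?thesis
          by (simp only: eq mult.assoc)
      qed
      ultimately show ?case
        by blast
    qed
    from lift[of r] obtain N r' where r': "f r * s ^ N = \<iota> r'"
      "\<And>u v. \<rho> r' (u, v) = (r * weyl_t ^ N * u, r * weyl_t ^ N * v)"
      by blast
    with that have "\<iota> r' = 0"
      by simp
    then obtain n where "r' * sj_s ^ n = 0"
      using localization by (auto simp: is_localization_def)
    \<comment> \<open>At \<open>(1, 0)\<close> the first component of the action is the Weyl algebra
      element \<open>r t^(N+n)\<close> itself.\<close>
    then have "\<rho> (r' * sj_s ^ n) (1, 0) = 0"
      by (simp add: \<rho>)
    then have "r * weyl_t ^ (N + n) = 0"
      by (simp add: \<rho> r' power_add mult.assoc zero_prod_def)
    then show ?thesis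
      by blast
  qed

  have regular: "f r = 0" if "r * weyl_t ^ n = 0" for r n
  proof -
    have "f r * s ^ n * s_inv ^ n = 0"
      using arg_cong[OF that, of f] by (simp add: f_simps f_power)
    then show ?thesis
      by (simp add: mult.assoc s_power_inverse)
  qed

  have "is_localization weyl_scale scl f {weyl_t ^ n | n. True} A"
    unfolding is_localization_def
  proof (intro conjI ballI allI)
    show "1 \<in> {weyl_t ^ n | n. True}"
      by (auto intro: exI[of _ 0])
    show "a * b \<in> {weyl_t ^ n | n. True}"
      if "a \<in> {weyl_t ^ n | n. True}" "b \<in> {weyl_t ^ n | n. True}" for a b :: "'k weyl"
      using that by (auto simp flip: power_add)
    show "\<exists>u\<in>A. f a * u = 1 \<and> u * f a = 1" if "a \<in> {weyl_t ^ n | n. True}" for a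
    proof -
      from that obtain n where "a = weyl_t ^ n"
        by blast
      then show ?thesis
        using s_power_inverse[of n] subalgebra_power[OF subalgebra_A A_gens(3), of n]
        by (metis f_power)
    qed
    show "\<exists>r. \<exists>b\<in>{weyl_t ^ n | n. True}. a * f b = f r" if "a \<in> A" for a
      using fraction[OF that] f_power by (metis (mono_tags, lifting) mem_Collect_eq)
    show "f r = 0 \<longleftrightarrow> (\<exists>b\<in>{weyl_t ^ n | n. True}. r * b = 0)" for r
      using torsion regular by blast
  qed (use subalgebra_A f(1) f_A in auto)
  then show ?thesis
    by blast
qed


subsection \<open>The matrix algebra\<close>

text \<open>Read off from the prescribed matrices: \<open>x\<close> is to be \<open>E21\<close>, so
  \<open>y' x\<close> becomes \<open>E11\<close>, \<open>x y'\<close> becomes \<open>E22\<close>,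
  and \<open>y' x y'\<close> becomes \<open>E12\<close>.\<close>

definition unit :: "2 \<Rightarrow> 2 \<Rightarrow> 'l" where
  "unit i j = (if i = 1 then if j = 1 then y' * x else y' * x * y' else if j = 1 then x else x * y')"

lemma x_y'_x: "x * (y' * x) = x"
proof -
  have "x * (x * y' + y' * x) = x"
    by (simp add: x_y')
  then show ?thesis
    by (simp add: distrib_left x_x flip: mult.assoc)
qed

sublocale matrix_units unit
proof
  \<comment> \<open>The relations are given a trailing factor \<open>a\<close> so that they also
    apply inside right-nested products.\<close>
  have [simp]: "x * (y' * (x * a)) = x * a" "x * (x * a) = 0"
      "x * (y' * (y' * a)) = y' * (y' * (x * a))" for a
    using arg_cong[OF x_y'_x, of "\<lambda>b. b * a"] arg_cong[OF x_x, of "\<lambda>b. b * a"]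
      arg_cong[OF x_y'_square, of "\<lambda>b. b * a"]
    by (simp_all add: mult.assoc power2_eq_square)
  show "unit i j * unit k l = (if j = k then unit i l else 0)" for i j k l
    using exhaust_2[of i] exhaust_2[of j] exhaust_2[of k] exhaust_2[of l]
    by (auto simp: unit_def mult.assoc x_y'_x x_x)
  show "(\<Sum>i\<in>UNIV. unit i i) = 1"
    using x_y' by (simp add: sum_2 unit_def add.commute)
qed

text \<open>The centralizer of the units is a subalgebra, so only the generators of \<open>A\<close>
  matter. Moving \<open>s\<close> past \<open>y'\<close> leaves a correction \<open>x\<close>, which
  meets another \<open>x\<close> in each unit and vanishes.\<close>

lemma A_commute: "a \<in> A \<Longrightarrow> a * unit i j = unit i j * a"
proof -
  let ?C = "{a. \<forall>b\<in>range (case_prod unit). a * b = b * a}"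
  have s_units: "s * (y' * x) = y' * x * s" "s * (x * y') = x * y' * s"
      "s * (y' * x * y') = y' * x * y' * s"
  proof -
    have move: "s * (x * a) = x * (s * a)" for a
      by (metis mult.assoc s_x)
    show "s * (x * y') = x * y' * s"
      by (simp add: move s_y' right_diff_distrib x_x mult.assoc)
    show yx: "s * (y' * x) = y' * x * s"
    proof -
      have "s * (y' * x) = (y' * s - x) * x"
        by (simp flip: s_y' mult.assoc)
      then show ?thesis
        by (simp add: left_diff_distrib x_x mult.assoc s_x)
    qed
    have "s * (y' * x * y') = y' * x * (s * y')"
      using arg_cong[OF yx, of "\<lambda>a. a * y'"] by (simp only: mult.assoc)
    then show "s * (y' * x * y') = y' * x * y' * s"
      by (simp add: s_y' right_diff_distrib x_x mult.assoc)
  qed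
  have p: "y'^2 * unit i j = unit i j * y'^2" for i j
    using arg_cong[OF x_y'_square, of "\<lambda>a. a * y'"] x_y'_square
    by (simp add: unit_def power2_eq_square mult.assoc)
  have s: "s * unit i j = unit i j * s" for i j
    using s_units s_x by (simp add: unit_def)
  have s_inv: "s_inv * unit i j = unit i j * s_inv" for i j
    by (metis inverse_s inverse_s_assoc(2) mult.assoc mult.right_neutral s)
  have "A \<subseteq> ?C"
    by (rule A_subset[OF subalgebra_centralizer]) (use p s s_inv in auto)
  then show "a * unit i j = unit i j * a" if "a \<in> A"
    using that by auto
qed

text \<open>Evaluating \<open>of_matrix\<close> on the prescribed matrices needs only
  \<open>x y' + y' x = 1\<close>; the values of \<open>to_matrix\<close> then follow by
  inversion.\<close>

lemma of_matrix_gens: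
  "of_matrix (mat2 0 0 1 0) = x" "of_matrix (mat2 c 0 0 c) = c" "of_matrix (mat2 0 1 (y'^2) 0) = y'"
proof -
  show "of_matrix (mat2 0 0 1 0) = x"
    by (simp add: of_matrix_def mat2_def sum_2 unit_def)
  show "of_matrix (mat2 c 0 0 c) = c"
    using x_y' by (simp add: of_matrix_def mat2_def sum_2 unit_def add.commute flip: distrib_left)
  have "y' * (x * y' + y' * x) = y'"
    by (simp add: x_y')
  then show "of_matrix (mat2 0 1 (y'^2) 0) = y'"
    by (simp add: of_matrix_def mat2_def sum_2 unit_def distrib_left power2_eq_square mult.assoc)
qed

lemma to_matrix_of_matrix_A: "M \<in> mat2_over A \<Longrightarrow> to_matrix (of_matrix M) = M"
  by (rule to_matrix_of_matrix) (simp add: mat2_over_def A_commute)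

lemma mat2_in: "a \<in> B \<Longrightarrow> b \<in> B \<Longrightarrow> c \<in> B \<Longrightarrow> d \<in> B \<Longrightarrow> mat2 a b c d \<in> mat2_over B"
  by (simp add: mat2_over_def mat2_def forall_2)

lemma gens_in_mat2_over:
  "mat2 0 0 1 0 \<in> mat2_over A" "mat2 s 0 0 s \<in> mat2_over A"
  "mat2 s_inv 0 0 s_inv \<in> mat2_over A" "mat2 0 1 (y'^2) 0 \<in> mat2_over A"
  by (intro mat2_in subalgebra_zero subalgebra_one subalgebra_A A_gens)+

lemma to_matrix_gens:
  "to_matrix x = mat2 0 0 1 0" "to_matrix s = mat2 s 0 0 s"
  "to_matrix s_inv = mat2 s_inv 0 0 s_inv" "to_matrix y' = mat2 0 1 (y'^2) 0"
  using gens_in_mat2_over[THEN to_matrix_of_matrix_A] by (simp_all only: of_matrix_gens)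

lemma to_matrix_scale: "to_matrix (scl c a) = mat2_scale scl c (to_matrix a)"
  by (simp add: to_matrix_def mat2_scale_def vec_eq_iff scale_mult_left scale_mult_right
      scale_sum_right)

lemma mat2_over_closed:
  fixes B :: "'l set"
  assumes "subalgebra scl B"
  shows "mat 1 \<in> mat2_over B"
    "M \<in> mat2_over B \<Longrightarrow> N \<in> mat2_over B \<Longrightarrow> M + N \<in> mat2_over B"
    "M \<in> mat2_over B \<Longrightarrow> mat2_scale scl c M \<in> mat2_over B"
    "M \<in> mat2_over B \<Longrightarrow> N \<in> mat2_over B \<Longrightarrow> M ** N \<in> mat2_over B"
  using assms
  by (auto simp: mat2_over_def mat_def mat2_scale_def matrix_matrix_mult_def sum_2
      subalgebra_one subalgebra_zero subalgebra_add subalgebra_scale subalgebra_mult)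

text \<open>The preimage of the matrices over \<open>A\<close> is a subalgebra containing the
  generators of the localization.\<close>

lemma to_matrix_in: "to_matrix a \<in> mat2_over A"
proof -
  have "subalgebra scl {a. to_matrix a \<in> mat2_over A}"
    by (rule subalgebraI)
      (simp_all add: to_matrix_one to_matrix_add to_matrix_scale to_matrix_mult
        mat2_over_closed[OF subalgebra_A])
  then have "a \<in> {a. to_matrix a \<in> mat2_over A}"
    by (rule in_generated) (simp_all add: to_matrix_gens gens_in_mat2_over)
  then show ?thesis
    by simp
qed

lemma to_matrix_hom: "algebra_hom_mat2 scl scl A to_matrix"
proof -
  have "module_hom scl (mat2_scale scl) to_matrix"
    by unfold_locales
      (simp_all add: to_matrix_add to_matrix_scale mat2_scale_def vec_eq_iff
        scale_right_distrib scale_left_distrib)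
  then show ?thesis
    by (simp add: algebra_hom_mat2_def assoc_algebra_axioms subalgebra_A to_matrix_in
        to_matrix_one to_matrix_mult)
qed

lemma to_matrix_bij: "bij_betw to_matrix UNIV (mat2_over A)"
  by (rule bij_betw_byWitness[where f' = of_matrix])
    (auto simp: of_matrix_to_matrix to_matrix_of_matrix_A to_matrix_in)

text \<open>The equalizer of two homomorphisms is a subalgebra, so agreement on generators suffices.
  This gives the uniqueness of the isomorphism.\<close>

lemma algebra_hom_mat2_eqI:
  assumes \<phi>: "algebra_hom_mat2 scl scl A \<phi>" and \<psi>: "algebra_hom_mat2 scl scl A \<psi>"
    and "\<phi> x = \<psi> x" "\<phi> y' = \<psi> y'" "\<phi> s = \<psi> s" "\<phi> s_inv = \<psi> s_inv"
  shows "\<phi> = \<psi>"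
proof
  fix a
  have "subalgebra scl {a. \<phi> a = \<psi> a}"
    using \<phi> \<psi> by (intro subalgebraI)
      (auto simp: algebra_hom_mat2_def module_hom.add module_hom.scale)
  then have "a \<in> {a. \<phi> a = \<psi> a}"
    by (rule in_generated) (use assms in simp_all)
  then show "\<phi> a = \<psi> a"
    by simp
qed

end

theorem lemma2p1:
  fixes scl :: "'k::field \<Rightarrow> 'l::ring_1 \<Rightarrow> 'l"
    and \<iota> :: "'k super_jordan \<Rightarrow> 'l"
    and x s s_inv y' :: 'l
    and A :: "'l set"
  assumes "CHAR('k) \<noteq> 2"
    and "is_localization sj_scale scl \<iota> {sj_s ^ n | n. True} UNIV"
    and "x = \<iota> sj_x" and "s = \<iota> sj_s"
    and "s * s_inv = 1" and "s_inv * s = 1"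
    and "y' = \<iota> sj_y * s_inv"
    and "A = subalgebra scl hull {y'^2, s, s_inv}"
  shows "(\<exists>S (f :: 'k weyl \<Rightarrow> 'l). is_localization weyl_scale scl f S A) \<and>
    (\<exists>\<phi>. algebra_hom_mat2 scl scl A \<phi> \<and> bij_betw \<phi> UNIV (mat2_over A) \<and>
         \<phi> x = mat2 0 0 1 0 \<and>
         \<phi> s = mat2 s 0 0 s \<and> \<phi> s_inv = mat2 s_inv 0 0 s_inv \<and>
         \<phi> y' = mat2 0 1 (y'^2) 0 \<and>
         (\<forall>\<psi>. algebra_hom_mat2 scl scl A \<psi> \<and> \<psi> x = mat2 0 0 1 0 \<and>
              \<psi> s = mat2 s 0 0 s \<and> \<psi> s_inv = mat2 s_inv 0 0 s_inv \<and>
              \<psi> y' = mat2 0 1 (y'^2) 0 \<longrightarrow> \<psi> = \<phi>))"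
proof -
  interpret J: sj_localization scl \<iota> s_inv
    by unfold_locales (use assms in simp_all)
  have eqs: "x = J.x" "s = J.s" "y' = J.y'"
    by (simp_all add: assms J.x_def J.s_def J.y'_def)
  have A: "A = J.A"
    by (simp only: assms(8) eqs J.A_def)
  show ?thesis
    unfolding eqs A
    using J.weyl_localization J.to_matrix_hom J.to_matrix_bij J.to_matrix_gens J.algebra_hom_mat2_eqI
    by (intro conjI exI[of _ J.to_matrix]) auto
qed

end
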